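(* Let $\alpha\in[-1,1]$, let $I:=[-1,1]\setminus\{\alpha\}$, and let $n=n_1+n_2$. Let $\mathcal{S}^{\alpha}_{n_1,n_2}$ be the non-polynomial interpolation operator based on the interpolation points $\{x_j: j=0,1,\ldots,n-1\}\subset I$. Let $K(x)=g_1(x)+g_2(x)\log|x-\alpha|$ for $x\in I$, with $g_1$ and $g_2$ smooth on $[-1,1]$. Define $$\tilde g_2(x)=\sum_{j=0}^{n_2-1}\frac{g_2^{(j)}(\alpha)}{j!}(x-\alpha)^j,\qquad \tilde g_1(x)=g_1(x)+\bigl(g_2(x)-\tilde g_2(x)\bigr)\log|x-\alpha| .$$ Then $$\|K-\mathcal{S}^{\alpha}_{n_1,n_2}K\|_1\le 2\bigl(1+\|\mathcal{S}^{\alpha}_{n_1,n_2}\|_{1,\infty}\bigr)\,\|\tilde g_1-\mathcal{S}_{n_1,0}\tilde g_1\|_\infty .$$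
   Context: $n_1,n_2$ are positive integers and $n=n_1+n_2$. For $\alpha\in[-1,1]$ and $I=[-1,1]\setminus\{\alpha\}$, set $$\mathbb{S}^{\alpha}_{n_1,n_2}(I):=\operatorname{span}\{x^j,\;x^k\log|x-\alpha| : j=0,\ldots,n_1-1,\;k=0,\ldots,n_2-1,\;x\in I\}.$$ Given distinct points $x_0,\ldots,x_{n-1}\in I$, the operator $\mathcal{S}^{\alpha}_{n_1,n_2}:C(I)\to\mathbb{S}^{\alpha}_{n_1,n_2}(I)$ maps $f$ to the function $\mathcal{S}^{\alpha}_{n_1,n_2}f\in\mathbb{S}^{\alpha}_{n_1,n_2}(I)$ with $(\mathcal{S}^{\alpha}_{n_1,n_2}f)(x_j)=f(x_j)$ for $j=0,\ldots,n-1$. Standing assumption: the points are such that this interpolation problem is uniquely solvable, so that the operator is well defined (it is then linear and is the identity on $\mathbb{S}^{\alpha}_{n_1,n_2}(I)$). When $n_2=0$ the operator is the ordinary polynomial interpolation operator, written $\mathcal{S}_{n_1,0}$: $\mathcal{S}_{n_1,0}f$ is the polynomial of degree less than $n_1$ interpolating $f$ at a set of $n_1$ distinct points of $I$. Norms: $\|u\|_1:=\int_{-1}^1|u(t)|\,dt$ for $u\in L^1(I)$; $\|\cdot\|_\infty$ is the supremum norm over $I$; and $$\|\mathcal{S}^{\alpha}_{n_1,n_2}\|_{1,\infty}:=\sup_{f\in C(I),\,\|f\|_\infty\ne0}\frac{\|\mathcal{S}^{\alpha}_{n_1,n_2}f\|_1}{\|f\|_\infty},$$ with the convention $1/\|f\|_\infty=0$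 if $f\in C(I)$ is unbounded. Here $C(I)$ denotes all continuous functions on $I$ (possibly unbounded). *)

theory Defs
  imports "HOL-Analysis.Analysis"
begin

definition punctured :: "real \<Rightarrow> real set" where
  "punctured \<alpha> = {-1..1} - {\<alpha>}"

(* Functions on I are represented by functions of type real => real.  Elements of the span are
   taken extensional (fixed to "undefined" off I), so that equality of elements is equality on I. *)
definition log_space :: "real \<Rightarrow> nat \<Rightarrow> nat \<Rightarrow> (real \<Rightarrow> real) set" where
  "log_space \<alpha> n1 n2 = {u \<in> extensional (punctured \<alpha>). \<exists>a b. \<forall>x\<in>punctured \<alpha>.
     u x = (\<Sum>j<n1. a j * x ^ j) + (\<Sum>k<n2. b k * (x ^ k * ln \<bar>x - \<alpha>\<bar>))}"

definition interpolates ::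
  "real \<Rightarrow> nat \<Rightarrow> nat \<Rightarrow> (nat \<Rightarrow> real) \<Rightarrow> (real \<Rightarrow> real) \<Rightarrow> (real \<Rightarrow> real) \<Rightarrow> bool" where
  "interpolates \<alpha> n1 n2 x f u \<longleftrightarrow> u \<in> log_space \<alpha> n1 n2 \<and> (\<forall>j<n1 + n2. u (x j) = f (x j))"

definition uniquely_solvable :: "real \<Rightarrow> nat \<Rightarrow> nat \<Rightarrow> (nat \<Rightarrow> real) \<Rightarrow> bool" where
  "uniquely_solvable \<alpha> n1 n2 x \<longleftrightarrow>
     (\<forall>f. continuous_on (punctured \<alpha>) f \<longrightarrow> (\<exists>!u. interpolates \<alpha> n1 n2 x f u))"

(* For n2 = 0 this is polynomial interpolation at the n1 points x 0, ..., x (n1 - 1). *)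
definition interp_op ::
  "real \<Rightarrow> nat \<Rightarrow> nat \<Rightarrow> (nat \<Rightarrow> real) \<Rightarrow> (real \<Rightarrow> real) \<Rightarrow> (real \<Rightarrow> real)" where
  "interp_op \<alpha> n1 n2 x f = (THE u. interpolates \<alpha> n1 n2 x f u)"

(* Norms take values in [0, \<infinity>]; the value of u at the single point \<alpha> does not affect the integral. *)
definition norm_1 :: "(real \<Rightarrow> real) \<Rightarrow> ennreal" where
  "norm_1 u = (\<integral>\<^sup>+ t\<in>{-1..1}. ennreal \<bar>u t\<bar> \<partial>lborel)"

definition norm_sup :: "real \<Rightarrow> (real \<Rightarrow> real) \<Rightarrow> ennreal" where
  "norm_sup \<alpha> u = (SUP t\<in>punctured \<alpha>. ennreal \<bar>u t\<bar>)"

(* Division in ennreal satisfies a / \<infinity> = 0, so unbounded f contribute 0 to the supremum. *)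
definition op_norm_1_sup :: "real \<Rightarrow> ((real \<Rightarrow> real) \<Rightarrow> (real \<Rightarrow> real)) \<Rightarrow> ennreal" where
  "op_norm_1_sup \<alpha> S =
     (SUP f\<in>{f. continuous_on (punctured \<alpha>) f \<and> norm_sup \<alpha> f \<noteq> 0}. norm_1 (S f) / norm_sup \<alpha> f)"

(* Derivatives relative to [-1,1]: one-sided at the endpoints, since g is only given on [-1,1]
   and \<alpha> may be an endpoint. *)
primrec deriv_n :: "nat \<Rightarrow> (real \<Rightarrow> real) \<Rightarrow> real \<Rightarrow> real" where
  "deriv_n 0 g = g"
| "deriv_n (Suc j) g = (\<lambda>x. vector_derivative (deriv_n j g) (at x within {-1..1}))"

definition smooth :: "(real \<Rightarrow> real) \<Rightarrow> bool" where
  "smooth g \<longleftrightarrow> (\<forall>j. deriv_n j g differentiable_on {-1..1})"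

definition g2_tilde :: "real \<Rightarrow> nat \<Rightarrow> (real \<Rightarrow> real) \<Rightarrow> real \<Rightarrow> real" where
  "g2_tilde \<alpha> n2 g2 x = (\<Sum>j<n2. deriv_n j g2 \<alpha> / fact j * (x - \<alpha>) ^ j)"

definition g1_tilde ::
  "real \<Rightarrow> nat \<Rightarrow> (real \<Rightarrow> real) \<Rightarrow> (real \<Rightarrow> real) \<Rightarrow> real \<Rightarrow> real" where
  "g1_tilde \<alpha> n2 g1 g2 x = g1 x + (g2 x - g2_tilde \<alpha> n2 g2 x) * ln \<bar>x - \<alpha>\<bar>"

end

theory Submission
  imports Defs "HOL-Computational_Algebra.Polynomial"
begin

text \<open>
  Write $I$ for the punctured interval, $p$ for the polynomial interpolant of $\tilde g_1$ and
  $E = \tilde g_1 - p$. On $I$ we have $K = \tilde g_1 + \tilde g_2 \log|x - \alpha| = E + w$ with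
  $w = p + \tilde g_2 \log|x - \alpha|$ in the log-polynomial space, which the operator fixes.
  Hence $K - \mathcal{S} K = E - \mathcal{S} E$, and the interval has length 2.
\<close>

section \<open>Polynomials with prescribed degree bound and their interpolation\<close>

lemma poly_eq_sum_lessThan:
  fixes p :: "'a::comm_semiring_1 poly"
  assumes "\<And>i. i \<ge> n \<Longrightarrow> coeff p i = 0"
  shows "poly p x = (\<Sum>i<n. coeff p i * x ^ i)"
proof -
  have "poly p x = (\<Sum>i\<in>{..degree p}. coeff p i * x ^ i)"
    by (simp add: poly_altdef)
  \<comment> \<open>Neither index set need contain the other, so the sum passes through their union;
    all added terms vanish.\<close>
  also have "\<dots> = (\<Sum>i\<in>{..degree p} \<union> {..<n}. coeff p i * x ^ i)"
    by (rule sum.mono_neutral_left) (auto simp: coeff_eq_0)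
  also have "\<dots> = (\<Sum>i<n. coeff p i * x ^ i)"
    by (rule sum.mono_neutral_right) (auto simp: assms)
  finally show ?thesis .
qed

text \<open>Each (X - a)^j with j < n has degree below n, so re-expansion at 0 stays within n
  coefficients. This turns the Taylor polynomial at \<alpha> into the monomials that span
  \<open>log_space\<close>.\<close>

lemma shifted_power_sum:
  fixes c :: "nat \<Rightarrow> 'a::comm_ring_1"
  obtains b where "\<And>t. (\<Sum>j<n. c j * (t - a) ^ j) = (\<Sum>k<n. b k * t ^ k)"
proof -
  define p where "p = (\<Sum>j<n. smult (c j) ([:- a, 1:] ^ j))"
  have "coeff p i = 0" if "i \<ge> n" for i
  proof -
    have "coeff ([:- a, 1:] ^ j) i = 0" if "j < n" for j
      using degree_power_le[of "[:- a, 1:]" j] that \<open>i \<ge> n\<close> by (intro coeff_eq_0) auto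
    then show ?thesis by (simp add: p_def coeff_sum)
  qed
  then have "(\<Sum>k<n. coeff p k * t ^ k) = (\<Sum>j<n. c j * (t - a) ^ j)" for t
    using poly_eq_sum_lessThan[of n p t] by (simp add: p_def poly_sum algebra_simps)
  then show thesis using that[of "coeff p"] by simp
qed

text \<open>Newton's scheme: a new node is accommodated by adding a multiple of the nodal polynomial
  of the earlier nodes. Bounding coefficients instead of the degree lets n = 0 serve as the base
  case.\<close>

lemma poly_interpolation_exists:
  fixes y f :: "nat \<Rightarrow> 'a::field"
  assumes "inj_on y {..<n}"
  shows "\<exists>p. (\<forall>i\<ge>n. coeff p i = 0) \<and> (\<forall>j<n. poly p (y j) = f j)"
  using assms
proof (induction n)
  case 0
  show ?case by (rule exI[of _ 0]) simp
next
  case (Suc n)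
  then have "inj_on y {..<n}" by (auto intro: inj_on_subset)
  with Suc.IH obtain p where p: "\<forall>i\<ge>n. coeff p i = 0" "\<forall>j<n. poly p (y j) = f j"
    by blast
  define w where "w = (\<Prod>j<n. [:- y j, 1:])"
  have w: "poly w t = (\<Prod>j<n. t - y j)" for t
    by (simp add: w_def poly_prod)
  have "poly w (y n) \<noteq> 0"
    using Suc.prems by (force simp: w inj_on_def)
  moreover have "degree w \<le> n"
    unfolding w_def using degree_prod_sum_le[of "{..<n}" "\<lambda>j. [:- y j, 1:]"] by simp
  moreover have "poly w (y j) = 0" if "j < n" for j
    using that by (auto simp: w)
  \<comment> \<open>Since \<open>w\<close> vanishes at the old nodes, the values there persist; the
    factor of \<open>w\<close> is the one that corrects the value at \<open>y n\<close>.\<close>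
  moreover define q where "q = p + smult ((f n - poly p (y n)) / poly w (y n)) w"
  ultimately have "poly q (y n) = f n" and "\<forall>j<n. poly q (y j) = f j"
    and "\<forall>i\<ge>Suc n. coeff q i = 0"
    using p by (simp_all add: coeff_eq_0)
  then show ?case by (metis less_Suc_eq)
qed

text \<open>The difference is a polynomial with n distinct roots and degree below n, hence
  zero.\<close>

lemma power_sum_unique:
  fixes y a b :: "nat \<Rightarrow> 'a::field"
  assumes "inj_on y {..<n}"
    and "\<And>j. j < n \<Longrightarrow> (\<Sum>i<n. a i * y j ^ i) = (\<Sum>i<n. b i * y j ^ i)"
    and "i < n"
  shows "a i = b i"
proof -
  define p where "p = (\<Sum>i<n. monom (a i - b i) i)"
  have c: "coeff p k = (if k < n then a k - b k else 0)" for k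
    by (auto simp: p_def coeff_sum)
  have "poly p (y j) = 0" if "j < n" for j
    using assms(2)[OF that]
    by (simp add: p_def poly_sum poly_monom algebra_simps sum_subtractf)
  \<comment> \<open>Here n is positive because i < n, so this bound lies strictly below the number n
    of roots.\<close>
  moreover have "degree p \<le> n - 1"
    using c by (intro degree_le) auto
  ultimately have "p = 0"
    using \<open>i < n\<close> card_image[OF assms(1)]
    by (intro poly_eqI_degree[of "y ` {..<n}"]) auto
  then show ?thesis using c[of i] \<open>i < n\<close> by simp
qed

text \<open>This makes the operator for n2 = 0 well defined at any distinct nodes of the punctured
  interval, so that its solvability is derived rather than assumed.\<close>

lemma uniquely_solvable_polynomial:
  assumes "inj_on y {..<n}" and "y ` {..<n} \<subseteq> punctured \<alpha>"
  shows "uniquely_solvable \<alpha> n 0 y"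
  unfolding uniquely_solvable_def
proof (intro allI impI)
  fix f
  obtain p where p: "\<And>i. i \<ge> n \<Longrightarrow> coeff p i = 0" "\<And>j. j < n \<Longrightarrow> poly p (y j) = f (y j)"
    using poly_interpolation_exists[OF assms(1), of "f \<circ> y"] by auto
  show "\<exists>!u. interpolates \<alpha> n 0 y f u"
  proof (rule ex1I)
    show "interpolates \<alpha> n 0 y f (restrict (poly p) (punctured \<alpha>))"
      using p assms(2) poly_eq_sum_lessThan[of n p]
      by (auto simp: interpolates_def log_space_def)
  next
    fix u assume u: "interpolates \<alpha> n 0 y f u"
    then obtain a where a: "\<And>t. t \<in> punctured \<alpha> \<Longrightarrow> u t = (\<Sum>j<n. a j * t ^ j)"
      and ext: "u \<in> extensional (punctured \<alpha>)"
      by (auto simp: interpolates_def log_space_def)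
    have "(\<Sum>i<n. a i * y j ^ i) = (\<Sum>i<n. coeff p i * y j ^ i)" if "j < n" for j
      using u that assms(2) a[of "y j"] p poly_eq_sum_lessThan[of n p "y j"]
      by (auto simp: interpolates_def image_subset_iff)
    then have "a i = coeff p i" if "i < n" for i
      using power_sum_unique[OF assms(1)] that by metis
    \<comment> \<open>Equal coefficients give agreement on the punctured interval; extensionality
      settles the values elsewhere.\<close>
    then show "u = restrict (poly p) (punctured \<alpha>)"
      using a ext poly_eq_sum_lessThan[of n p] p(1)
      by (intro extensionalityI[of _ "punctured \<alpha>"]) auto
  qed
qed

section \<open>The log-polynomial space and its interpolation operator\<close>

lemma log_space_add:
  assumes "u \<in> log_space \<alpha> n1 n2" and "v \<in> log_space \<alpha> n1 n2"
  shows "restrict (\<lambda>t. u t + v t) (punctured \<alpha>) \<in> log_space \<alpha> n1 n2"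
proof -
  obtain a b a' b' where
    "\<forall>x\<in>punctured \<alpha>. u x = (\<Sum>j<n1. a j * x ^ j) + (\<Sum>k<n2. b k * (x ^ k * ln \<bar>x - \<alpha>\<bar>))"
    "\<forall>x\<in>punctured \<alpha>. v x = (\<Sum>j<n1. a' j * x ^ j) + (\<Sum>k<n2. b' k * (x ^ k * ln \<bar>x - \<alpha>\<bar>))"
    using assms unfolding log_space_def by blast
  then have "\<forall>x\<in>punctured \<alpha>. u x + v x
      = (\<Sum>j<n1. (a j + a' j) * x ^ j) + (\<Sum>k<n2. (b k + b' k) * (x ^ k * ln \<bar>x - \<alpha>\<bar>))"
    by (simp add: distrib_right sum.distrib)
  then have "\<exists>a b. \<forall>x\<in>punctured \<alpha>. u x + v x
      = (\<Sum>j<n1. a j * x ^ j) + (\<Sum>k<n2. b k * (x ^ k * ln \<bar>x - \<alpha>\<bar>))"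
    by (rule exI[of _ "\<lambda>j. a j + a' j", OF exI[of _ "\<lambda>k. b k + b' k"]])
  then show ?thesis
    by (simp add: log_space_def)
qed

lemma log_space_continuous:
  assumes "u \<in> log_space \<alpha> n1 n2"
  shows "continuous_on (punctured \<alpha>) u"
proof -
  obtain a b where "\<forall>x\<in>punctured \<alpha>.
      u x = (\<Sum>j<n1. a j * x ^ j) + (\<Sum>k<n2. b k * (x ^ k * ln \<bar>x - \<alpha>\<bar>))"
    using assms unfolding log_space_def by blast
  moreover have "continuous_on (punctured \<alpha>)
      (\<lambda>x. (\<Sum>j<n1. a j * x ^ j) + (\<Sum>k<n2. b k * (x ^ k * ln \<bar>x - \<alpha>\<bar>)))"
    by (intro continuous_intros) (auto simp: punctured_def)
  ultimately show ?thesis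
    by (simp cong: continuous_on_cong)
qed

lemma interp_op_interpolates:
  assumes "uniquely_solvable \<alpha> n1 n2 x" and "continuous_on (punctured \<alpha>) f"
  shows "interpolates \<alpha> n1 n2 x f (interp_op \<alpha> n1 n2 x f)"
  using assms theI'[of "interpolates \<alpha> n1 n2 x f"]
  by (simp add: interp_op_def uniquely_solvable_def)

lemma interp_op_eqI:
  assumes "uniquely_solvable \<alpha> n1 n2 x" and "continuous_on (punctured \<alpha>) f"
    and "interpolates \<alpha> n1 n2 x f u"
  shows "interp_op \<alpha> n1 n2 x f = u"
  using assms interp_op_interpolates[OF assms(1,2)] unfolding uniquely_solvable_def by blast

text \<open>The interpolant of f plus w lies in the space and matches g at the nodes, so uniqueness
  identifies it. Additivity and reproduction of the space are thus used at once. The relation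
  between g and f is required on the punctured interval alone, because \<open>K\<close> is specified
  only there.\<close>

lemma interp_op_add_log_space:
  assumes solv: "uniquely_solvable \<alpha> n1 n2 x" and x: "x ` {..<n1 + n2} \<subseteq> punctured \<alpha>"
    and f: "continuous_on (punctured \<alpha>) f" and w: "w \<in> log_space \<alpha> n1 n2"
    and g: "\<And>t. t \<in> punctured \<alpha> \<Longrightarrow> g t = f t + w t" and t: "t \<in> punctured \<alpha>"
  shows "interp_op \<alpha> n1 n2 x g t = interp_op \<alpha> n1 n2 x f t + w t"
proof -
  let ?u = "interp_op \<alpha> n1 n2 x f"
  have "continuous_on (punctured \<alpha>) (\<lambda>t. f t + w t)"
    by (intro continuous_intros f log_space_continuous[OF w])
  then have "continuous_on (punctured \<alpha>) g"
    using g by (simp cong: continuous_on_cong)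
  moreover have "interpolates \<alpha> n1 n2 x g (restrict (\<lambda>t. ?u t + w t) (punctured \<alpha>))"
    using interp_op_interpolates[OF solv f] w x g log_space_add
    by (auto simp: interpolates_def image_subset_iff)
  ultimately show ?thesis
    using interp_op_eqI[OF solv] t by simp
qed

text \<open>The zero function is its own interpolant. This serves the case of supremum norm 0, which
  the operator norm excludes.\<close>

lemma interp_op_eq_0:
  assumes "uniquely_solvable \<alpha> n1 n2 x" and "x ` {..<n1 + n2} \<subseteq> punctured \<alpha>"
    and f: "\<And>t. t \<in> punctured \<alpha> \<Longrightarrow> f t = 0" and "t \<in> punctured \<alpha>"
  shows "interp_op \<alpha> n1 n2 x f t = 0"
proof -
  have "continuous_on (punctured \<alpha>) f"
    using f by (simp cong: continuous_on_cong)
  moreover have "interpolates \<alpha> n1 n2 x f (restrict (\<lambda>t. 0) (punctured \<alpha>))"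
    using assms(2) f
    by (auto simp: interpolates_def image_subset_iff log_space_def intro!: exI[of _ "\<lambda>_. 0"])
  ultimately show ?thesis
    using interp_op_eqI[OF assms(1)] assms(4) by simp
qed

section \<open>Estimates for the integral norm and the operator norm\<close>

lemma norm_1_punctured: "norm_1 u = (\<integral>\<^sup>+ t\<in>punctured \<alpha>. ennreal \<bar>u t\<bar> \<partial>lborel)"
  unfolding norm_1_def
proof (rule nn_integral_cong_AE)
  show "AE t in lborel. ennreal \<bar>u t\<bar> * indicator {-1..1} t
      = ennreal \<bar>u t\<bar> * indicator (punctured \<alpha>) t"
    \<comment> \<open>The two indicators can differ only at \<alpha>, a Lebesgue null set.\<close>
    using AE_lborel_singleton[of \<alpha>]
    by eventually_elim (auto simp: punctured_def indicator_def)
qed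

text \<open>Pointwise triangle inequality, with u replaced by its supremum and integrated as a
  constant. Continuity of v supplies the measurability needed to split the integral.\<close>

lemma norm_1_diff_le:
  assumes "continuous_on (punctured \<alpha>) v"
    and d: "\<And>t. t \<in> punctured \<alpha> \<Longrightarrow> d t = u t - v t"
  shows "norm_1 d \<le> 2 * norm_sup \<alpha> u + norm_1 v"
proof -
  let ?I = "punctured \<alpha>"
  have I [measurable]: "?I \<in> sets borel" by (simp add: punctured_def)
  \<comment> \<open>Continuity of v is known only on \<open>?I\<close>, so measurability is obtained
    for its product with the indicator.\<close>
  have "(\<lambda>t. ennreal \<bar>indicator ?I t *\<^sub>R v t\<bar>) \<in> borel_measurable borel"
    using borel_measurable_continuous_on_indicator[OF I assms(1)] by measurable
  also have "(\<lambda>t. ennreal \<bar>indicator ?I t *\<^sub>R v t\<bar>) = (\<lambda>t. ennreal \<bar>v t\<bar> * indicator ?I t)"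
    by (auto simp: indicator_def)
  finally have v [measurable]: "(\<lambda>t. ennreal \<bar>v t\<bar> * indicator ?I t) \<in> borel_measurable borel" .
  have "ennreal \<bar>d t\<bar> \<le> norm_sup \<alpha> u + ennreal \<bar>v t\<bar>" if "t \<in> ?I" for t
  proof -
    have "ennreal \<bar>d t\<bar> \<le> ennreal \<bar>u t\<bar> + ennreal \<bar>v t\<bar>"
      using d[OF that] by (simp flip: ennreal_plus add: ennreal_leI)
    also have "\<dots> \<le> norm_sup \<alpha> u + ennreal \<bar>v t\<bar>"
      unfolding norm_sup_def using that by (intro add_right_mono SUP_upper)
    finally show ?thesis .
  qed
  then have "norm_1 d \<le> (\<integral>\<^sup>+ t. norm_sup \<alpha> u * indicator ?I t + ennreal \<bar>v t\<bar> * indicator ?I t \<partial>lborel)"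
    unfolding norm_1_punctured[of _ \<alpha>]
    by (intro nn_integral_mono) (auto simp: indicator_def)
  also have "\<dots> = norm_sup \<alpha> u * emeasure lborel ?I + norm_1 v"
    unfolding norm_1_punctured[of _ \<alpha>]
    by (subst nn_integral_add) (auto simp: nn_integral_cmult_indicator)
  \<comment> \<open>The constant 2 is the length of [-1,1].\<close>
  also have "emeasure lborel ?I \<le> emeasure lborel {-1..1::real}"
    by (intro emeasure_mono) (auto simp: punctured_def)
  then have "norm_sup \<alpha> u * emeasure lborel ?I \<le> 2 * norm_sup \<alpha> u"
    by (simp add: mult.commute mult_left_mono)
  finally show ?thesis by (simp add: add_right_mono)
qed

lemma norm_sup_eq_0D:
  assumes "norm_sup \<alpha> f = 0" and "t \<in> punctured \<alpha>"
  shows "f t = 0"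
proof -
  have "ennreal \<bar>f t\<bar> \<le> norm_sup \<alpha> f"
    unfolding norm_sup_def using assms(2) by (rule SUP_upper)
  then show ?thesis using assms(1) by simp
qed

lemma norm_1_le_op_norm:
  assumes f: "continuous_on (punctured \<alpha>) f"
    and "norm_sup \<alpha> f \<noteq> 0" and "norm_sup \<alpha> f \<noteq> \<infinity>"
  shows "norm_1 (S f) \<le> op_norm_1_sup \<alpha> S * norm_sup \<alpha> f"
proof -
  have "norm_1 (S f) / norm_sup \<alpha> f \<le> op_norm_1_sup \<alpha> S"
    unfolding op_norm_1_sup_def using assms by (intro SUP_upper) simp
  then have "norm_1 (S f) / norm_sup \<alpha> f * norm_sup \<alpha> f \<le> op_norm_1_sup \<alpha> S * norm_sup \<alpha> f"
    by (rule mult_right_mono) simp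
  \<comment> \<open>Cancellation in \<open>ennreal\<close> uses that the divisor is neither 0 nor
    infinite.\<close>
  also have "norm_1 (S f) / norm_sup \<alpha> f * norm_sup \<alpha> f = norm_1 (S f)"
    using assms by (simp add: ennreal_divide_times ennreal_mult_divide_eq less_top)
  finally show ?thesis .
qed

text \<open>For a nonzero finite supremum norm this is the triangle inequality followed by the
  operator norm bound. The two extreme values escape that bound: at 0 the left side vanishes, at
  infinity the right side is infinite.\<close>

lemma norm_1_diff_interp_op_le:
  assumes solv: "uniquely_solvable \<alpha> n1 n2 x" and x: "x ` {..<n1 + n2} \<subseteq> punctured \<alpha>"
    and f: "continuous_on (punctured \<alpha>) f"
    and d: "\<And>t. t \<in> punctured \<alpha> \<Longrightarrow> d t = f t - interp_op \<alpha> n1 n2 x f t"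
  shows "norm_1 d \<le> 2 * (1 + op_norm_1_sup \<alpha> (interp_op \<alpha> n1 n2 x)) * norm_sup \<alpha> f"
proof -
  let ?S = "interp_op \<alpha> n1 n2 x"
  consider "norm_sup \<alpha> f = 0" | "norm_sup \<alpha> f = \<infinity>" | "norm_sup \<alpha> f \<noteq> 0" "norm_sup \<alpha> f \<noteq> \<infinity>"
    by blast
  then show ?thesis
  proof cases
    case 1
    then have "d t = 0" if "t \<in> punctured \<alpha>" for t
      using that d interp_op_eq_0[OF solv x] norm_sup_eq_0D by simp
    then have "(\<lambda>t. ennreal \<bar>d t\<bar> * indicator (punctured \<alpha>) t) = (\<lambda>t. 0)"
      by (force simp: indicator_def)
    then have "norm_1 d = 0"
      by (simp add: norm_1_punctured[of d \<alpha>])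
    then show ?thesis by simp
  next
    case 2
    \<comment> \<open>The factor 2 * (1 + ...) is nonzero, so its product with infinity is
      infinity.\<close>
    then show ?thesis by (simp add: ennreal_mult_eq_top_iff)
  next
    case 3
    have "?S f \<in> log_space \<alpha> n1 n2"
      using interp_op_interpolates[OF solv f] by (simp add: interpolates_def)
    then have "norm_1 d \<le> 2 * norm_sup \<alpha> f + norm_1 (?S f)"
      by (rule norm_1_diff_le[OF log_space_continuous d])
    \<comment> \<open>Doubling this bound lets the factor 2 be pulled out of both summands, as the
      claimed constant requires.\<close>
    also have "norm_1 (?S f) \<le> 2 * (op_norm_1_sup \<alpha> ?S * norm_sup \<alpha> f)"
      using norm_1_le_op_norm[OF f 3, of ?S]
      by (metis add_increasing mult_2 zero_le)
    finally show ?thesis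
      by (simp add: algebra_simps add_left_mono)
  qed
qed

theorem theorem2p2:
  fixes \<alpha> :: real and n1 n2 :: nat
    and x y :: "nat \<Rightarrow> real" and g1 g2 K :: "real \<Rightarrow> real"
  assumes "\<alpha> \<in> {-1..1}" and "n1 > 0" and "n2 > 0"
    and "inj_on x {..<n1 + n2}" and "x ` {..<n1 + n2} \<subseteq> punctured \<alpha>"
    and "uniquely_solvable \<alpha> n1 n2 x"
    and "inj_on y {..<n1}" and "y ` {..<n1} \<subseteq> punctured \<alpha>"
    and "smooth g1" and "smooth g2"
    and "\<And>t. t \<in> punctured \<alpha> \<Longrightarrow> K t = g1 t + g2 t * ln \<bar>t - \<alpha>\<bar>"
  shows "norm_1 (\<lambda>t. K t - interp_op \<alpha> n1 n2 x K t)
      \<le> 2 * (1 + op_norm_1_sup \<alpha> (interp_op \<alpha> n1 n2 x))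
        * norm_sup \<alpha> (\<lambda>t. g1_tilde \<alpha> n2 g1 g2 t - interp_op \<alpha> n1 0 y (g1_tilde \<alpha> n2 g1 g2) t)"
proof -
  let ?h = "g1_tilde \<alpha> n2 g1 g2"
  define p where "p = interp_op \<alpha> n1 0 y ?h"
  define E where "E = (\<lambda>t. ?h t - p t)"
  have g: "continuous_on (punctured \<alpha>) g" if "smooth g" for g
  proof (rule continuous_on_subset)
    \<comment> \<open>The instance j = 0 of \<open>smooth\<close> yields continuity of the function
      itself.\<close>
    have "deriv_n 0 g differentiable_on {-1..1}"
      using that unfolding smooth_def by blast
    then show "continuous_on {-1..1} g"
      by (simp add: differentiable_imp_continuous_on)
  qed (auto simp: punctured_def)
  have h: "continuous_on (punctured \<alpha>) ?h"
    unfolding g1_tilde_def g2_tilde_def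
    by (intro continuous_intros g assms) (auto simp: punctured_def)
  have "p \<in> log_space \<alpha> n1 0"
    using interp_op_interpolates[OF uniquely_solvable_polynomial[OF assms(7,8)] h]
    by (simp add: p_def interpolates_def)
  then have p: "continuous_on (punctured \<alpha>) p"
    and "\<exists>a. \<forall>t\<in>punctured \<alpha>. p t = (\<Sum>j<n1. a j * t ^ j)"
    using log_space_continuous by (blast, simp add: log_space_def)
  then obtain a where a: "\<And>t. t \<in> punctured \<alpha> \<Longrightarrow> p t = (\<Sum>j<n1. a j * t ^ j)"
    by blast
  have E: "continuous_on (punctured \<alpha>) E"
    unfolding E_def by (intro continuous_intros h p)
  \<comment> \<open>The Taylor polynomial, given in powers of t - \<alpha>, is rewritten in powers
    of t to fit the span.\<close>
  obtain b where b: "\<And>t. g2_tilde \<alpha> n2 g2 t = (\<Sum>k<n2. b k * t ^ k)"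
    using shifted_power_sum[where c = "\<lambda>j. deriv_n j g2 \<alpha> / fact j" and a = \<alpha> and n = n2]
    unfolding g2_tilde_def by blast
  \<comment> \<open>The restriction makes \<open>w\<close> extensional, as membership in
    \<open>log_space\<close> demands.\<close>
  define w where
    "w = restrict (\<lambda>t. p t + g2_tilde \<alpha> n2 g2 t * ln \<bar>t - \<alpha>\<bar>) (punctured \<alpha>)"
  have w: "w \<in> log_space \<alpha> n1 n2"
  proof -
    have "\<forall>t\<in>punctured \<alpha>. w t
        = (\<Sum>j<n1. a j * t ^ j) + (\<Sum>k<n2. b k * (t ^ k * ln \<bar>t - \<alpha>\<bar>))"
      by (simp add: w_def a b sum_distrib_right mult.assoc)
    then show ?thesis
      unfolding log_space_def by (auto simp: w_def)
  qed
  \<comment> \<open>The interpolant \<open>p\<close> cancels between \<open>E\<close> and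
    \<open>w\<close>, as do the two logarithmic terms with \<open>g2_tilde\<close>.\<close>
  have K: "K t = E t + w t" if "t \<in> punctured \<alpha>" for t
    using assms(11)[OF that] that by (simp add: E_def w_def g1_tilde_def algebra_simps)
  have "K t - interp_op \<alpha> n1 n2 x K t = E t - interp_op \<alpha> n1 n2 x E t" if "t \<in> punctured \<alpha>" for t
    using interp_op_add_log_space[OF assms(6,5) E w K that] K[OF that] by simp
  from norm_1_diff_interp_op_le[OF assms(6,5) E this]
  show ?thesis by (simp add: E_def p_def)
qed

end
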